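(* Let $n\ge 4$ and let $\mathcal{L}(f)=\int_{[-1,1]^n}\rho_1(x_1)\rho_2(x_2)\cdots\rho_n(x_n)\,f(x_1,\dots,x_n)\,dx_1\cdots dx_n$, where each $\rho_i\ge 0$ is a symmetric weight function on $[-1,1]$ with $\int_{-1}^1\rho_i(x)\,dx=1$ and $\int_{-1}^1\rho_i(x)x^{2k+1}\,dx=0$ for every nonnegative integer $k$. Then there exists a cubature formula $C_n$ for $\mathcal{L}$ of degree five which uses at most $n^2+5n+3$ points.
   Context: A cubature formula for $\mathcal{L}$ with $N$ points is a linear functional $C(f)=\sum_{j=1}^N w_j f(\mathbf{x}^{(j)})$ with real weights $w_j$ (of any sign) and points $\mathbf{x}^{(j)}\in\mathbb{R}^n$; the points are not required to lie in the integration region. It is of degree five if $C(f)=\mathcal{L}(f)$ for every real polynomial $f$ in $n$ variables of total degree at most $5$. Symmetric means $\rho_i(-x)=\rho_i(x)$. *)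

theory Defs
  imports "HOL-Analysis.Analysis"
begin

definition poly_fun_le :: "nat \<Rightarrow> (real ^ 'n \<Rightarrow> real) \<Rightarrow> bool" where
  "poly_fun_le d f \<longleftrightarrow>
     (\<exists>c :: ('n \<Rightarrow> nat) \<Rightarrow> real. \<forall>x.
        f x = (\<Sum>\<alpha> | (\<Sum>i\<in>UNIV. \<alpha> i) \<le> d. c \<alpha> * (\<Prod>i\<in>UNIV. (x $ i) ^ \<alpha> i)))"

text \<open>The outer sum above is genuine: it ranges over a finite set of exponent vectors.\<close>

lemma finite_exponents: "finite {\<alpha> :: 'n::finite \<Rightarrow> nat. (\<Sum>i\<in>UNIV. \<alpha> i) \<le> d}"
proof (rule finite_subset)
  have "\<alpha> i \<le> d" if "(\<Sum>i\<in>UNIV. \<alpha> i) \<le> d" for \<alpha> :: "'n \<Rightarrow> nat" and i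
    using member_le_sum[of i UNIV \<alpha>] that by simp
  then show "{\<alpha> :: 'n \<Rightarrow> nat. (\<Sum>i\<in>UNIV. \<alpha> i) \<le> d} \<subseteq> (\<Pi>\<^sub>E i\<in>UNIV. {..d})"
    by (simp add: PiE_UNIV_domain subset_iff Pi_iff)
  show "finite (\<Pi>\<^sub>E i\<in>(UNIV :: 'n set). {..d})"
    by (rule finite_PiE) simp_all
qed

definition product_integral :: "('n \<Rightarrow> real \<Rightarrow> real) \<Rightarrow> (real ^ 'n \<Rightarrow> real) \<Rightarrow> real" where
  "product_integral \<rho> f =
     (LINT x : cbox (- 1) 1 | lebesgue. (\<Prod>i\<in>UNIV. \<rho> i (x $ i)) * f x)"

text \<open>The points need not lie in the cube, need not be distinct, and weights may have any sign.\<close>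

definition cubature ::
  "nat \<Rightarrow> (nat \<Rightarrow> real) \<Rightarrow> (nat \<Rightarrow> real ^ 'n) \<Rightarrow> (real ^ 'n \<Rightarrow> real) \<Rightarrow> real" where
  "cubature N w p f = (\<Sum>j = 1..N. w j * f (p j))"

definition has_degree ::
  "((real ^ 'n \<Rightarrow> real) \<Rightarrow> real) \<Rightarrow> ((real ^ 'n \<Rightarrow> real) \<Rightarrow> real) \<Rightarrow> nat \<Rightarrow> bool" where
  "has_degree C L d \<longleftrightarrow> (\<forall>f. poly_fun_le d f \<longrightarrow> C f = L f)"

end

theory Submission imports Defs begin

text \<open>
Rescaling each coordinate by its standard deviation makes all second moments equal to 1. The moments of
degree at most five are then those of \<open>x\<^sub>i\<^sup>2\<close> and \<open>x\<^sub>i\<^sup>2 x\<^sub>j\<^sup>2\<close>, which are 1, and those of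
\<open>x\<^sub>i\<^sup>4\<close>, some numbers \<open>b\<^sub>i\<close>; all others of positive degree vanish. As quartic forms, the fourth
moments are \<open>3 |y|^4 + (\<Sum>i. (b\<^sub>i - 3) y\<^sub>i^4)\<close>.

The building block is an antipodal pair \<open>\<plusminus>u / sqrt s\<close> in which each point has weight \<open>\<kappa> s\<^sup>2 / 2\<close>: its odd
moments vanish, its fourth moments are those of \<open>\<kappa> u\<^sup>\<otimes>\<^sup>4\<close> whatever \<open>s\<close> is, and its second moments are
those of \<open>\<kappa> s u\<^sup>\<otimes>\<^sup>2\<close>. The parameter \<open>s > 0\<close> therefore moves the second moments without touching the fourth.

Let \<open>v\<^sub>0, \<dots>, v\<^sub>n\<close> be the vertices of a regular simplex centred at the origin, scaled so that
\<open>\<Sum>k. v\<^sub>k v\<^sub>k\<^sup>T\<close> is the identity matrix. Then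
\<open>(\<Sum>k<l. \<langle>v\<^sub>k + v\<^sub>l, y\<rangle>^4) + (7 - n) (\<Sum>k. \<langle>v\<^sub>k, y\<rangle>^4) = 3 |y|^4\<close>, so the directions
\<open>v\<^sub>k + v\<^sub>l\<close> and \<open>v\<^sub>k\<close>, which need \<open>(n + 1) (n + 2)\<close> points, produce the isotropic part of the fourth moments.
The rest comes from \<open>2 n\<close> points on the axes, with coefficients \<open>\<gamma>\<^sub>i = b\<^sub>i - 3\<close> of any sign and a common
parameter \<open>s = \<epsilon>\<close>. These add \<open>\<epsilon> \<gamma>\<^sub>i\<close> to the second moment of \<open>x\<^sub>i\<close>, an error which has to be undone by the
simplex points. This is where \<open>n > 3\<close> enters: every diagonal matrix is then a linear combination of the
matrices \<open>(v\<^sub>k + v\<^sub>l) (v\<^sub>k + v\<^sub>l)\<^sup>T\<close> with \<open>k < l\<close> (lemma \<open>increasing_pairs_diag\<close>). With \<open>s = 1/6\<close> at all simplex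
points their second moments are the identity, and for small \<open>\<epsilon>\<close> the values of \<open>s\<close> at the pairs can be
perturbed by that linear combination and stay positive. The origin finally absorbs the moment of degree 0,
which makes \<open>(n + 1) (n + 2) + 2 n + 1 = n\<^sup>2 + 5 n + 3\<close> points (theorem \<open>normalized_cubature\<close>).
\<close>

section \<open>Integrals of products of functions of one coordinate\<close>

lemma prod_Basis_vec:
  "(\<Prod>b\<in>(Basis :: (real ^ 'n::finite) set). g b) = (\<Prod>i\<in>UNIV. g (axis i 1))"
proof -
  have "(Basis :: (real ^ 'n) set) = (\<lambda>i. axis i 1) ` UNIV"
    by (auto simp: Basis_vec_def)
  moreover have "inj (\<lambda>i :: 'n. axis i (1::real) :: real ^ 'n)"
    by (auto simp: inj_on_def axis_eq_axis)
  ultimately show ?thesis by (intro prod.reindex_cong) auto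
qed

text \<open>
The Lebesgue measure on \<open>real ^ 'n\<close> is defined as a product over the set of basis vectors, so a family
indexed by coordinates has to be reindexed by basis vectors.
\<close>

definition basis_index :: "real ^ 'n::finite \<Rightarrow> 'n" where
  "basis_index b = (THE i. b = axis i 1)"

lemma basis_index_axis [simp]: "basis_index (axis i 1) = i"
  unfolding basis_index_def by (simp add: axis_eq_axis)

lemma vec_nth_sum_Basis:
  fixes f :: "real ^ 'n::finite \<Rightarrow> real"
  shows "(\<Sum>b\<in>Basis. f b *\<^sub>R b) $ i = f (axis i 1)"
proof -
  have "(\<Sum>b\<in>Basis. f b *\<^sub>R b) $ i = (\<Sum>b\<in>Basis. f b *\<^sub>R b) \<bullet> axis i 1"
    by (simp add: inner_axis)
  also have "\<dots> = f (axis i 1)"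
    by (subst inner_sum_left_Basis) (auto simp: axis_in_Basis_iff)
  finally show ?thesis .
qed

lemma lborel_prod_integral:
  fixes f :: "'n::finite \<Rightarrow> real \<Rightarrow> real"
  assumes f: "\<And>i. integrable lborel (f i)"
  shows "integrable lborel (\<lambda>x :: real ^ 'n. \<Prod>i\<in>UNIV. f i (x $ i))" (is ?int)
    and "integral\<^sup>L lborel (\<lambda>x :: real ^ 'n. \<Prod>i\<in>UNIV. f i (x $ i)) = (\<Prod>i\<in>UNIV. integral\<^sup>L lborel (f i))" (is ?eq)
proof -
  interpret product_sigma_finite "\<lambda>_ :: real ^ 'n. lborel :: real measure"
    by standard
  have [measurable]: "f i \<in> borel_measurable borel" for i
    using f[of i] by (simp add: borel_measurable_integrable)
  let ?P = "\<Pi>\<^sub>M b\<in>(Basis :: (real ^ 'n) set). (lborel :: real measure)"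
  let ?T = "\<lambda>y :: real ^ 'n \<Rightarrow> real. \<Sum>b\<in>Basis. y b *\<^sub>R b"
  have T: "?T \<in> measurable ?P borel" by measurable
  have F: "(\<lambda>x :: real ^ 'n. \<Prod>i\<in>UNIV. f i (x $ i)) \<in> borel_measurable borel"
    by measurable
  have eq: "(\<Prod>i\<in>UNIV. f i (?T y $ i)) = (\<Prod>b\<in>Basis. f (basis_index b) (y b))" for y
    by (simp only: prod_Basis_vec vec_nth_sum_Basis basis_index_axis)
  show ?int
    by (subst lborel_eq, subst integrable_distr_eq[OF T F], unfold eq)
       (intro product_integrable_prod finite_Basis f)
  show ?eq
    by (subst lborel_eq, subst integral_distr[OF T F], unfold eq,
        subst product_integral_prod) (auto simp: f prod_Basis_vec)
qed

text \<open>
The preimage of a null set \<open>N\<close> under a coordinate projection is a product with \<open>N\<close> as one factor and the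
whole line as the others; its measure is 0 because \<open>0 * \<infinity> = 0\<close> for extended nonnegative reals.
\<close>

lemma AE_lborel_vec_nth:
  assumes "AE t in lborel. P t"
  shows "AE x in (lborel :: (real ^ 'n::finite) measure). P (x $ i)"
proof -
  from assms obtain N where N: "N \<in> null_sets (lborel :: real measure)" "{t. \<not> P t} \<subseteq> N"
    by (auto elim!: eventually_ae_filter[THEN iffD1, elim_format])
  then have [measurable]: "N \<in> sets borel" by auto
  let ?h = "\<lambda>(b :: real ^ 'n) t. if b = axis i 1 then indicator N t else (1 :: ennreal)"
  have "(\<integral>\<^sup>+x. (indicator N (x $ i) :: ennreal) \<partial>(lborel :: (real ^ 'n) measure))
      = (\<integral>\<^sup>+x. (\<Prod>b\<in>Basis. ?h b (x \<bullet> b)) \<partial>lborel)"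
    by (intro nn_integral_cong) (simp add: prod_Basis_vec axis_eq_axis inner_axis prod.delta if_distrib)
  also have "\<dots> = (\<Prod>b\<in>Basis. \<integral>\<^sup>+t. ?h b t \<partial>lborel)"
    by (rule nn_integral_lborel_prod) auto
  also have "\<dots> = 0"
  proof (rule prod_zero)
    have "(\<integral>\<^sup>+t. (indicator N t :: ennreal) \<partial>lborel) = 0"
      using N(1) by (simp add: null_sets_def)
    then show "\<exists>b\<in>Basis. (\<integral>\<^sup>+t. ?h b t \<partial>lborel) = 0"
      by (intro bexI[of _ "axis i 1"]) (auto simp: axis_in_Basis_iff)
  qed simp
  finally have "AE x in (lborel :: (real ^ 'n) measure). (indicator N (x $ i) :: ennreal) = 0"
    by (subst (asm) nn_integral_0_iff_AE) auto
  then show ?thesis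
    by eventually_elim (use N(2) in \<open>auto simp: indicator_def split: if_splits\<close>)
qed

text \<open>
Fubini's theorem for the factors of a Lebesgue measurable product: each factor is replaced by a Borel
function that agrees with it almost everywhere. The products then also agree almost everywhere, since
coordinate projections pull null sets back to null sets.
\<close>

lemma lebesgue_prod_integral:
  fixes f :: "'n::finite \<Rightarrow> real \<Rightarrow> real"
  assumes f: "\<And>i. integrable lebesgue (f i)"
  shows "integrable lebesgue (\<lambda>x :: real ^ 'n. \<Prod>i\<in>UNIV. f i (x $ i))"
    and "integral\<^sup>L lebesgue (\<lambda>x :: real ^ 'n. \<Prod>i\<in>UNIV. f i (x $ i)) = (\<Prod>i\<in>UNIV. integral\<^sup>L lebesgue (f i))"
proof -
  have "\<forall>i. \<exists>g. g \<in> borel_measurable lborel \<and> (AE t in lborel. f i t = g t)"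
    using completion_ex_borel_measurable_real[OF borel_measurable_integrable[OF f]] by blast
  from choice[OF this] obtain g
    where g: "\<And>i. g i \<in> borel_measurable lborel" and fg: "\<And>i. AE t in lborel. f i t = g i t"
    by blast
  have [measurable]: "g i \<in> borel_measurable borel" for i
    using g[of i] by simp
  have fgL: "AE t in lebesgue. f i t = g i t" for i
    using fg by (rule AE_completion)
  have g_meas: "g i \<in> borel_measurable lebesgue" for i
    by (rule measurable_completion) simp
  have g_int: "integrable lebesgue (g i)" for i
    using f g_meas fgL by (rule Bochner_Integration.integrable_cong_AE_imp)
  then have g_int': "integrable lborel (g i)" for i
    by (simp add: integrable_completion)
  note G = lborel_prod_integral[of g, OF g_int']
  let ?F = "\<lambda>x :: real ^ 'n. \<Prod>i\<in>UNIV. f i (x $ i)"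
  let ?G = "\<lambda>x :: real ^ 'n. \<Prod>i\<in>UNIV. g i (x $ i)"
  have "AE x in (lborel :: (real ^ 'n) measure). \<forall>i. f i (x $ i) = g i (x $ i)"
    unfolding AE_all_countable using AE_lborel_vec_nth[OF fg] by blast
  then have "AE x in lborel. ?G x = ?F x"
    by eventually_elim simp
  then have GF: "AE x in lebesgue. ?G x = ?F x"
    by (rule AE_completion)
  have G_int: "integrable lebesgue ?G"
    using G(1) by (simp add: integrable_completion)
  then have G_meas: "?G \<in> borel_measurable lebesgue" by simp
  then have F_meas: "?F \<in> borel_measurable lebesgue"
    using GF by (rule borel_measurable_AE)
  show "integrable lebesgue ?F"
    using G_int F_meas GF by (rule Bochner_Integration.integrable_cong_AE_imp)
  have "integral\<^sup>L lebesgue ?F = integral\<^sup>L lebesgue ?G"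
    using G_meas F_meas GF by (rule integral_cong_AE[symmetric])
  also have "\<dots> = (\<Prod>i\<in>UNIV. integral\<^sup>L lborel (g i))"
    using G(2) by (simp add: integral_completion)
  also have "\<dots> = (\<Prod>i\<in>UNIV. integral\<^sup>L lebesgue (f i))"
  proof (rule prod.cong[OF refl])
    fix i
    have "integral\<^sup>L lebesgue (f i) = integral\<^sup>L lebesgue (g i)"
      using borel_measurable_integrable[OF f] g_meas fgL by (rule integral_cong_AE)
    then show "integral\<^sup>L lborel (g i) = integral\<^sup>L lebesgue (f i)"
      by (simp add: integral_completion)
  qed
  finally show "integral\<^sup>L lebesgue ?F = (\<Prod>i\<in>UNIV. integral\<^sup>L lebesgue (f i))" .
qed

section \<open>Pairs of vertices of a regular simplex\<close>

text \<open>
Each unordered pair of distinct indices is represented once. Any injective enumeration could serve here;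
the one of the class of countable types avoids an order on the index type.
\<close>

definition increasing_pairs :: "('k::countable \<times> 'k) set" where
  "increasing_pairs = {(k, l). to_nat k < to_nat l}"

lemma sum_increasing_pairs:
  fixes f :: "'k::finite \<Rightarrow> 'k \<Rightarrow> real"
  assumes sym: "\<And>k l. f k l = f l k"
  shows "2 * (\<Sum>(k, l)\<in>increasing_pairs. f k l) = (\<Sum>k\<in>UNIV. \<Sum>l\<in>UNIV. f k l) - (\<Sum>k\<in>UNIV. f k k)"
proof -
  let ?L = "increasing_pairs :: ('k \<times> 'k) set" and ?G = "{(k, l). to_nat (l :: 'k) < to_nat (k :: 'k)}"
  let ?D = "{(k, l). (k :: 'k) = l}"
  have "(\<Sum>(k, l)\<in>?G. f k l) = (\<Sum>(k, l)\<in>?L. f k l)"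
    by (rule sum.reindex_bij_witness[of _ prod.swap prod.swap]) (auto simp: sym increasing_pairs_def)
  moreover have "(\<Sum>(k, l)\<in>?D. f k l) = (\<Sum>k\<in>UNIV. f k k)"
    by (rule sum.reindex_bij_witness[of _ "\<lambda>k. (k, k)" fst]) auto
  moreover have "(\<Sum>k\<in>UNIV. \<Sum>l\<in>UNIV. f k l) = (\<Sum>(k, l)\<in>?L \<union> ?G \<union> ?D. f k l)"
  proof -
    have "?L \<union> ?G \<union> ?D = UNIV"
      by (auto simp: increasing_pairs_def) (metis linorder_neqE_nat to_nat_split)
    then show ?thesis by (simp add: sum.cartesian_product)
  qed
  moreover have "\<dots> = (\<Sum>(k, l)\<in>?L. f k l) + (\<Sum>(k, l)\<in>?G. f k l) + (\<Sum>(k, l)\<in>?D. f k l)"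
    by (subst sum.union_disjoint; (force simp: increasing_pairs_def)?)+
  ultimately show ?thesis by simp
qed

lemma card_increasing_pairs:
  "2 * card (increasing_pairs :: ('k::finite \<times> 'k) set) = CARD('k) * (CARD('k) - 1)"
proof -
  have "real (2 * card (increasing_pairs :: ('k \<times> 'k) set)) = real (CARD('k) * (CARD('k) - 1))"
    using sum_increasing_pairs[of "\<lambda>(k :: 'k) l. 1"] by (simp add: case_prod_unfold algebra_simps of_nat_diff)
  then show ?thesis by (simp only: of_nat_eq_iff)
qed

definition delta :: "'a \<Rightarrow> 'a \<Rightarrow> real" where "delta i j = of_bool (i = j)"

text \<open>
The \<open>n + 1\<close> vertices of a regular simplex in dimension \<open>n\<close>. One vertex points in the direction
\<open>-(1, \<dots>, 1)\<close>; the others are unit vectors shifted along the diagonal. The shift is a root of the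
quadratic equation which makes the matrix with these rows have orthonormal columns.
\<close>

definition simplex_vertex :: "'n::finite option \<Rightarrow> 'n \<Rightarrow> real" where
  "simplex_vertex k i =
     (let q = 1 / sqrt (CARD('n) + 1) in
      case k of None \<Rightarrow> - q | Some j \<Rightarrow> delta i j - (1 - q) / CARD('n))"

lemma sum_UNIV_option: "(\<Sum>k\<in>(UNIV :: 'n::finite option set). f k) = f None + (\<Sum>j\<in>UNIV. f (Some j))"
  by (simp add: UNIV_option_conv sum.reindex)

lemma simplex_vertex_sum: "(\<Sum>k\<in>UNIV. simplex_vertex k i) = 0"
  by (simp add: sum_UNIV_option simplex_vertex_def Let_def delta_def sum_subtractf)

lemma simplex_vertex_frame:
  "(\<Sum>k\<in>UNIV. simplex_vertex k i * simplex_vertex k j) = delta i (j :: 'n::finite)"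
proof -
  define q where "q = 1 / sqrt (real CARD('n) + 1)"
  define n where "n = real CARD('n)"
  define c where "c = (1 - q) / n"
  have n: "n > 0" unfolding n_def by simp
  have q: "q * q * (n + 1) = 1"
    using n by (simp add: q_def n_def)
  have c: "n * c = 1 - q" using n by (simp add: c_def)
  have "(\<Sum>k\<in>UNIV. simplex_vertex k i * simplex_vertex k j)
      = q * q + (\<Sum>k\<in>UNIV. (delta i k - c) * (delta j k - c))"
    by (simp add: sum_UNIV_option simplex_vertex_def Let_def q_def c_def n_def add.commute)
  also have "(\<Sum>k\<in>UNIV. (delta i k - c) * (delta j k - c))
      = (\<Sum>k\<in>UNIV. delta i k * delta j k) - c * (\<Sum>k\<in>UNIV. delta i k) - c * (\<Sum>k\<in>UNIV. delta j k) + n * (c * c)"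
    by (simp add: algebra_simps sum.distrib sum_subtractf sum_distrib_left n_def)
  also have "\<dots> = delta i j - 2 * c + n * (c * c)"
    by (simp add: delta_def)
  also have "q * q + \<dots> = delta i j"
  proof -
    have "n * (q * q - 2 * c + n * (c * c)) = n * (q * q) - 2 * (n * c) + (n * c) * (n * c)"
      by (simp add: algebra_simps)
    also have "\<dots> = 0" unfolding c using q by (simp add: algebra_simps)
    finally show ?thesis using n by simp
  qed
  finally show ?thesis .
qed

text \<open>
All that is used of the simplex is that its vertices sum to zero and that \<open>\<Sum>k. v\<^sub>k v\<^sub>k\<^sup>T\<close> is the identity.
\<close>

locale tight_frame =
  fixes v :: "'k::finite \<Rightarrow> 'n::finite \<Rightarrow> real"
  assumes centred: "(\<Sum>k\<in>UNIV. v k i) = 0"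
    and frame: "(\<Sum>k\<in>UNIV. v k i * v k j) = delta i j"
begin

text \<open>
Of the sixteen terms in the expansion, those with a single factor on one side vanish because the vertices
are centred. Those with two factors on either side give products of second moments, and the remaining two
are fourth moments of the vertices.
\<close>

lemma pair_sums_fourth:
  "(\<Sum>k\<in>UNIV. \<Sum>l\<in>UNIV. (v k a + v l a) * (v k b + v l b) * (v k c + v l c) * (v k d + v l d))
    = 2 * real CARD('k) * (\<Sum>k\<in>UNIV. v k a * v k b * v k c * v k d)
      + 2 * (delta a b * delta c d + delta a c * delta b d + delta a d * delta b c)"
proof -
  have 1: "(\<Sum>k\<in>UNIV. \<Sum>l\<in>UNIV. f k * g l) = (\<Sum>k\<in>UNIV. f k) * (\<Sum>l\<in>UNIV. g l)" for f g :: "'k \<Rightarrow> real"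
    by (simp add: sum_product)
  have "(\<Sum>k\<in>UNIV. \<Sum>l\<in>UNIV. (v k a + v l a) * (v k b + v l b) * (v k c + v l c) * (v k d + v l d))
    = (\<Sum>k\<in>UNIV. \<Sum>l\<in>UNIV. (v k a * v k b * v k c * v k d) * 1 + 1 * (v l a * v l b * v l c * v l d)
       + (v k a * v k b) * (v l c * v l d) + (v k a * v k c) * (v l b * v l d) + (v k a * v k d) * (v l b * v l c)
       + (v k b * v k c) * (v l a * v l d) + (v k b * v k d) * (v l a * v l c) + (v k c * v k d) * (v l a * v l b)
       + (v k a * v k b * v k c) * v l d + (v k a * v k b * v k d) * v l c
       + (v k a * v k c * v k d) * v l b + (v k b * v k c * v k d) * v l a
       + v k a * (v l b * v l c * v l d) + v k b * (v l a * v l c * v l d)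
       + v k c * (v l a * v l b * v l d) + v k d * (v l a * v l b * v l c))"
    by (intro sum.cong refl) (simp add: algebra_simps)
  also have "\<dots> = 2 * real CARD('k) * (\<Sum>k\<in>UNIV. v k a * v k b * v k c * v k d)
      + 2 * (delta a b * delta c d + delta a c * delta b d + delta a d * delta b c)"
    unfolding sum.distrib 1 centred frame by (simp add: algebra_simps)
  finally show ?thesis .
qed

lemma pair_sums_second:
  "(\<Sum>k\<in>UNIV. \<Sum>l\<in>UNIV. (v k a + v l a) * (v k b + v l b)) = 2 * real CARD('k) * delta a b"
proof -
  have 1: "(\<Sum>k\<in>UNIV. \<Sum>l\<in>UNIV. f k * g l) = (\<Sum>k\<in>UNIV. f k) * (\<Sum>l\<in>UNIV. g l)" for f g :: "'k \<Rightarrow> real"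
    by (simp add: sum_product)
  have "(\<Sum>k\<in>UNIV. \<Sum>l\<in>UNIV. (v k a + v l a) * (v k b + v l b))
    = (\<Sum>k\<in>UNIV. \<Sum>l\<in>UNIV. (v k a * v k b) * 1 + 1 * (v l a * v l b) + v k a * v l b + v k b * v l a)"
    by (intro sum.cong refl) (simp add: algebra_simps)
  also have "\<dots> = 2 * real CARD('k) * delta a b"
    unfolding sum.distrib 1 centred frame by simp
  finally show ?thesis .
qed

text \<open>
The matrix \<open>V \<Gamma> V\<^sup>T\<close>, where \<open>V\<close> has the rows \<open>v\<^sub>k\<close> and \<open>\<Gamma>\<close> is the diagonal matrix with entries \<open>\<gamma>\<^sub>i\<close>.
\<close>

definition gram :: "('n \<Rightarrow> real) \<Rightarrow> 'k \<Rightarrow> 'k \<Rightarrow> real" where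
  "gram \<gamma> k l = (\<Sum>i\<in>UNIV. \<gamma> i * v k i * v l i)"

text \<open>
Coefficients that express \<open>\<Gamma>\<close> through the matrices \<open>u\<^sub>k\<^sub>l u\<^sub>k\<^sub>l\<^sup>T\<close>, where \<open>u\<^sub>k\<^sub>l = v\<^sub>k + v\<^sub>l\<close> and \<open>k < l\<close>.
Let \<open>m\<close> be the Gram matrix and \<open>n\<close> one less than the number of vertices. Since \<open>V\<^sup>T V\<close> is the identity,
\<open>\<Gamma> = V\<^sup>T m V = (\<Sum>k l. m\<^sub>k\<^sub>l v\<^sub>k v\<^sub>l\<^sup>T)\<close>. As the rows of \<open>m\<close> sum to zero, polarization of the mixed terms turns
this into \<open>(\<Sum>k<l. m\<^sub>k\<^sub>l u\<^sub>k\<^sub>l u\<^sub>k\<^sub>l\<^sup>T) + 2 (\<Sum>k. m\<^sub>k\<^sub>k v\<^sub>k v\<^sub>k\<^sup>T)\<close>. The squares of the vertices are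
eliminated by \<open>(\<Sum>l\<noteq>k. u\<^sub>k\<^sub>l u\<^sub>k\<^sub>l\<^sup>T) = (n - 3) v\<^sub>k v\<^sub>k\<^sup>T + I\<close> and the identity matrix by
\<open>(\<Sum>k<l. u\<^sub>k\<^sub>l u\<^sub>k\<^sub>l\<^sup>T) = (n - 1) I\<close>; this explains the two denominators.
\<close>

definition diag_coeff :: "('n \<Rightarrow> real) \<Rightarrow> 'k \<Rightarrow> 'k \<Rightarrow> real" where
  "diag_coeff \<gamma> k l = gram \<gamma> k l + 2 / (real CARD('k) - 4) * (gram \<gamma> k k + gram \<gamma> l l)
     - 2 / ((real CARD('k) - 4) * (real CARD('k) - 2)) * (\<Sum>i\<in>UNIV. \<gamma> i)"

lemma gram_sym: "gram \<gamma> k l = gram \<gamma> l k"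
  by (simp add: gram_def mult_ac)

lemma sum_gram_mult: "(\<Sum>l\<in>UNIV. gram \<gamma> k l * v l a) = \<gamma> a * v k a"
proof -
  have "(\<Sum>l\<in>UNIV. gram \<gamma> k l * v l a) = (\<Sum>i\<in>UNIV. \<gamma> i * v k i * (\<Sum>l\<in>UNIV. v l i * v l a))"
    unfolding gram_def sum_distrib_left sum_distrib_right
    by (subst sum.swap) (simp add: mult_ac)
  also have "\<dots> = \<gamma> a * v k a" by (simp add: frame delta_def if_distrib sum.delta)
  finally show ?thesis .
qed

lemma sum_gram: "(\<Sum>l\<in>UNIV. gram \<gamma> k l) = 0"
proof -
  have "(\<Sum>l\<in>UNIV. gram \<gamma> k l) = (\<Sum>i\<in>UNIV. \<gamma> i * v k i * (\<Sum>l\<in>UNIV. v l i))"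
    unfolding gram_def sum_distrib_left by (subst sum.swap) simp
  then show ?thesis by (simp add: centred)
qed

lemma trace_gram: "(\<Sum>k\<in>UNIV. gram \<gamma> k k) = (\<Sum>i\<in>UNIV. \<gamma> i)"
proof -
  have "(\<Sum>k\<in>UNIV. gram \<gamma> k k) = (\<Sum>i\<in>UNIV. \<gamma> i * (\<Sum>k\<in>UNIV. v k i * v k i))"
    unfolding gram_def sum_distrib_left by (subst sum.swap) (simp add: mult_ac)
  then show ?thesis by (simp add: frame delta_def)
qed

lemma pair_sums_gram:
  "(\<Sum>k\<in>UNIV. \<Sum>l\<in>UNIV. gram \<gamma> k l * ((v k a + v l a) * (v k b + v l b))) = 2 * \<gamma> a * delta a b"
proof -
  have "(\<Sum>l\<in>UNIV. gram \<gamma> k l * ((v k a + v l a) * (v k b + v l b)))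
     = v k a * v k b * (\<Sum>l\<in>UNIV. gram \<gamma> k l) + v k a * (\<Sum>l\<in>UNIV. gram \<gamma> k l * v l b)
       + v k b * (\<Sum>l\<in>UNIV. gram \<gamma> k l * v l a) + (\<Sum>l\<in>UNIV. gram \<gamma> k l * (v l a * v l b))" for k
    by (simp add: sum_distrib_left sum.distrib[symmetric] algebra_simps)
  moreover have "(\<Sum>k\<in>UNIV. \<Sum>l\<in>UNIV. gram \<gamma> k l * (v l a * v l b)) = 0"
    by (subst sum.swap, subst gram_sym) (simp add: sum_distrib_right[symmetric] sum_gram)
  moreover have "(\<Sum>k\<in>UNIV. v k a * (\<gamma> b * v k b)) = \<gamma> b * (\<Sum>k\<in>UNIV. v k a * v k b)"
     "(\<Sum>k\<in>UNIV. v k b * (\<gamma> a * v k a)) = \<gamma> a * (\<Sum>k\<in>UNIV. v k a * v k b)"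
    by (simp_all add: sum_distrib_left mult_ac)
  ultimately show ?thesis
    by (simp add: sum_gram sum_gram_mult sum.distrib frame delta_def)
qed

lemma pair_sums_left:
  fixes h :: "'k \<Rightarrow> real"
  shows "(\<Sum>k\<in>UNIV. \<Sum>l\<in>UNIV. h k * ((v k a + v l a) * (v k b + v l b)))
    = CARD('k) * (\<Sum>k\<in>UNIV. h k * (v k a * v k b)) + (\<Sum>k\<in>UNIV. h k) * delta a b"
proof -
  have "(\<Sum>l\<in>UNIV. h k * ((v k a + v l a) * (v k b + v l b)))
     = CARD('k) * (h k * (v k a * v k b)) + h k * v k a * (\<Sum>l\<in>UNIV. v l b)
       + h k * v k b * (\<Sum>l\<in>UNIV. v l a) + h k * (\<Sum>l\<in>UNIV. v l a * v l b)" for k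
    by (simp add: sum_distrib_left sum.distrib algebra_simps)
  then show ?thesis
    by (simp add: centred frame sum.distrib sum_distrib_left sum_distrib_right)
qed

text \<open>
Only pairs of distinct indices are wanted; summing over all pairs and subtracting the diagonal lets every
double sum factor. Ordered pairs count each unordered pair twice, hence the factor 2.
\<close>

lemma pair_sums_diag:
  assumes K: "CARD('k) > 4"
  shows "(\<Sum>k\<in>UNIV. \<Sum>l\<in>UNIV. diag_coeff \<gamma> k l * ((v k a + v l a) * (v k b + v l b)))
      - (\<Sum>k\<in>UNIV. diag_coeff \<gamma> k k * ((v k a + v k a) * (v k b + v k b))) = 2 * \<gamma> a * delta a b"
proof -
  define K where "K = real CARD('k)"
  define t where "t = (\<Sum>i\<in>UNIV. \<gamma> i)"
  define Q where "Q = (\<Sum>k\<in>UNIV. gram \<gamma> k k * (v k a * v k b))"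
  have K4: "K - 4 > 0" "K - 2 > 0" using K by (auto simp: K_def)
  let ?p = "\<lambda>k l. (v k a + v l a) * (v k b + v l b)"
  have swap: "(\<Sum>k\<in>UNIV. \<Sum>l\<in>UNIV. gram \<gamma> l l * ?p k l) = (\<Sum>k\<in>UNIV. \<Sum>l\<in>UNIV. gram \<gamma> k k * ?p k l)"
    by (subst sum.swap) (simp add: add.commute)
  \<comment> \<open>The sums are separated for arbitrary functions, so that the products inside are not multiplied out.\<close>
  have lin: "(\<Sum>k\<in>UNIV. \<Sum>l\<in>UNIV. (A k l + x * (h k + h l) - y * z) * p k l)
      = (\<Sum>k\<in>UNIV. \<Sum>l\<in>UNIV. A k l * p k l)
        + x * ((\<Sum>k\<in>UNIV. \<Sum>l\<in>UNIV. h k * p k l) + (\<Sum>k\<in>UNIV. \<Sum>l\<in>UNIV. h l * p k l))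
        - y * z * (\<Sum>k\<in>UNIV. \<Sum>l\<in>UNIV. p k l)" for A p :: "'k \<Rightarrow> 'k \<Rightarrow> real" and h x y z
    by (simp add: algebra_simps sum.distrib sum_subtractf sum_distrib_left)
  have "(\<Sum>k\<in>UNIV. \<Sum>l\<in>UNIV. diag_coeff \<gamma> k l * ?p k l)
     = (\<Sum>k\<in>UNIV. \<Sum>l\<in>UNIV. gram \<gamma> k l * ?p k l)
       + 2 / (K - 4) * ((\<Sum>k\<in>UNIV. \<Sum>l\<in>UNIV. gram \<gamma> k k * ?p k l) + (\<Sum>k\<in>UNIV. \<Sum>l\<in>UNIV. gram \<gamma> l l * ?p k l))
       - 2 / ((K - 4) * (K - 2)) * t * (\<Sum>k\<in>UNIV. \<Sum>l\<in>UNIV. ?p k l)"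
    unfolding diag_coeff_def K_def[symmetric] t_def[symmetric] by (rule lin)
  also have "\<dots> = 2 * \<gamma> a * delta a b + 4 / (K - 4) * (K * Q + t * delta a b)
       - 4 * K / ((K - 4) * (K - 2)) * t * delta a b"
    unfolding swap pair_sums_gram pair_sums_second pair_sums_left trace_gram
    by (simp add: K_def t_def Q_def algebra_simps)
  finally have A: "(\<Sum>k\<in>UNIV. \<Sum>l\<in>UNIV. diag_coeff \<gamma> k l * ?p k l) = \<dots>" .
  have "diag_coeff \<gamma> k k * ?p k k
      = 4 * (gram \<gamma> k k * (v k a * v k b)) + 16 / (K - 4) * (gram \<gamma> k k * (v k a * v k b))
        - 8 / ((K - 4) * (K - 2)) * t * (v k a * v k b)" for k
    unfolding diag_coeff_def K_def[symmetric] t_def[symmetric] by (simp add: algebra_simps)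
  then have B: "(\<Sum>k\<in>UNIV. diag_coeff \<gamma> k k * ?p k k)
      = 4 * Q + 16 / (K - 4) * Q - 8 / ((K - 4) * (K - 2)) * t * delta a b"
    by (simp only: sum.distrib sum_subtractf sum_distrib_left[symmetric] frame Q_def[symmetric])
  have "4 / (K - 4) * K * Q = 4 * Q + 16 / (K - 4) * Q"
    using K4 by (simp add: field_simps)
  moreover have "4 / (K - 4) = (4 * K - 8) / ((K - 4) * (K - 2))"
  proof -
    have "(4 * K - 8) = 4 * (K - 2)" by simp
    then show ?thesis using K4 by (simp only: mult_divide_mult_cancel_right)
  qed
  then have "4 / (K - 4) * t * delta a b = (4 * K - 8) / ((K - 4) * (K - 2)) * t * delta a b"
    by (simp only:)
  ultimately show ?thesis unfolding A B by (simp add: algebra_simps diff_divide_distrib add_divide_distrib)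
qed


text \<open>
The first summand is removed by giving the vertices themselves the coefficient 8 minus their number; the
second is the isotropic form \<open>3 |y|^4\<close>, written as a symmetric tensor.
\<close>

lemma increasing_pairs_fourth:
  "(\<Sum>(k, l)\<in>increasing_pairs. (v k a + v l a) * (v k b + v l b) * (v k c + v l c) * (v k d + v l d))
    = (real CARD('k) - 8) * (\<Sum>k\<in>UNIV. v k a * v k b * v k c * v k d)
      + (delta a b * delta c d + delta a c * delta b d + delta a d * delta b c)" (is "?lhs = _")
proof -
  have "2 * ?lhs
      = (\<Sum>k\<in>UNIV. \<Sum>l\<in>UNIV. (v k a + v l a) * (v k b + v l b) * (v k c + v l c) * (v k d + v l d))
        - (\<Sum>k\<in>UNIV. (v k a + v k a) * (v k b + v k b) * (v k c + v k c) * (v k d + v k d))"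
    by (rule sum_increasing_pairs) (simp add: add.commute)
  moreover have "(\<Sum>k\<in>UNIV. (v k a + v k a) * (v k b + v k b) * (v k c + v k c) * (v k d + v k d))
      = 16 * (\<Sum>k\<in>UNIV. v k a * v k b * v k c * v k d)"
    by (simp add: sum_distrib_left mult_ac)
  moreover have "x = (n - 8) * T + e" if "2 * x = 2 * n * T + 2 * e - z" "z = 16 * T" for x n T e z :: real
    using that by (simp add: algebra_simps)
  ultimately show ?thesis
    unfolding pair_sums_fourth by blast
qed

lemma increasing_pairs_second:
  "(\<Sum>(k, l)\<in>increasing_pairs. (v k a + v l a) * (v k b + v l b)) = (real CARD('k) - 2) * delta a b"
  (is "?lhs = _")
proof -
  have "2 * ?lhs = (\<Sum>k\<in>UNIV. \<Sum>l\<in>UNIV. (v k a + v l a) * (v k b + v l b))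
      - (\<Sum>k\<in>UNIV. (v k a + v k a) * (v k b + v k b))"
    by (rule sum_increasing_pairs) (simp add: add.commute)
  moreover have "(\<Sum>k\<in>UNIV. (v k a + v k a) * (v k b + v k b)) = 4 * (\<Sum>k\<in>UNIV. v k a * v k b)"
    by (simp add: sum_distrib_left mult_ac)
  ultimately show ?thesis
    unfolding pair_sums_second frame left_diff_distrib by linarith
qed

lemma increasing_pairs_diag:
  assumes K: "CARD('k) > 4"
  shows "(\<Sum>(k, l)\<in>increasing_pairs. diag_coeff \<gamma> k l * ((v k a + v l a) * (v k b + v l b))) = \<gamma> a * delta a b"
    (is "?lhs = _")
proof -
  have "diag_coeff \<gamma> k l = diag_coeff \<gamma> l k" for k l
    by (simp add: diag_coeff_def gram_sym[of \<gamma> k l] add.commute)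
  then have "2 * ?lhs = (\<Sum>k\<in>UNIV. \<Sum>l\<in>UNIV. diag_coeff \<gamma> k l * ((v k a + v l a) * (v k b + v l b)))
      - (\<Sum>k\<in>UNIV. diag_coeff \<gamma> k k * ((v k a + v k a) * (v k b + v k b)))"
    by (intro sum_increasing_pairs) (simp add: add.commute)
  then show ?thesis
    unfolding pair_sums_diag[OF K] by simp
qed

end

section \<open>Cubature functionals and monomials\<close>

text \<open>
Points are counted with repetition, so that the number of points is additive under sums of functionals.
\<close>

definition is_cubature :: "nat \<Rightarrow> ((real ^ 'n \<Rightarrow> real) \<Rightarrow> real) \<Rightarrow> bool" where
  "is_cubature N F \<longleftrightarrow> (\<exists>w p. F = cubature N w p)"

lemma is_cubature_eval: "is_cubature 1 (\<lambda>g. c * g q)"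
  unfolding is_cubature_def cubature_def
  by (rule exI[of _ "\<lambda>_. c"], rule exI[of _ "\<lambda>_. q"]) simp

lemma is_cubature_add:
  assumes "is_cubature M F" "is_cubature N G"
  shows "is_cubature (M + N) (\<lambda>g. F g + G g)"
proof -
  from assms obtain w p w' p' where F: "F = cubature M w p" and G: "G = cubature N w' p'"
    by (auto simp: is_cubature_def)
  let ?w = "\<lambda>j. if j \<le> M then w j else w' (j - M)" and ?p = "\<lambda>j. if j \<le> M then p j else p' (j - M)"
  have "F g + G g = cubature (M + N) ?w ?p g" for g
  proof -
    have "cubature (M + N) ?w ?p g
        = (\<Sum>j = 1..M. ?w j * g (?p j)) + (\<Sum>j = 1 + M..N + M. ?w j * g (?p j))"
      unfolding cubature_def by (subst sum.ub_add_nat) (auto simp: add.commute)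
    then show ?thesis
      unfolding F G cubature_def by (subst (asm) sum.shift_bounds_cl_nat_ivl) simp
  qed
  then show ?thesis by (auto simp: is_cubature_def fun_eq_iff intro!: exI[of _ ?w] exI[of _ ?p])
qed

lemma is_cubature_sum:
  assumes "finite S" "\<And>s. s \<in> S \<Longrightarrow> is_cubature N (F s)"
  shows "is_cubature (card S * N) (\<lambda>g. \<Sum>s\<in>S. F s g)"
  using assms
proof (induction S)
  case empty
  show ?case by (auto simp: is_cubature_def cubature_def fun_eq_iff)
next
  case (insert s S)
  then show ?case using is_cubature_add[of N "F s" "card S * N" "\<lambda>g. \<Sum>s\<in>S. F s g"] by simp
qed

lemma is_cubature_map:
  assumes "is_cubature N F"
  shows "is_cubature N (\<lambda>g. F (\<lambda>x. g (S x)))"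
proof -
  from assms obtain w p where "F = cubature N w p" by (auto simp: is_cubature_def)
  then show ?thesis
    by (auto simp: is_cubature_def cubature_def fun_eq_iff intro!: exI[of _ w] exI[of _ "\<lambda>j. S (p j)"])
qed

lemma is_cubature_linear:
  assumes "is_cubature N F"
  shows "F (\<lambda>x. \<Sum>a\<in>A. c a * g a x) = (\<Sum>a\<in>A. c a * F (g a))"
proof -
  from assms obtain w p where F: "F = cubature N w p" by (auto simp: is_cubature_def)
  show ?thesis
    unfolding F cubature_def sum_distrib_left by (subst sum.swap) (simp add: mult_ac)
qed

lemma is_cubature_cmult:
  assumes "is_cubature N F"
  shows "F (\<lambda>x. c * g x) = c * F g"
  using is_cubature_linear[OF assms, where A = "{()}" and c = "\<lambda>_. c" and g = "\<lambda>_. g"] by simp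

definition monomial :: "('n \<Rightarrow> nat) \<Rightarrow> real ^ 'n \<Rightarrow> real" where
  "monomial \<alpha> x = (\<Prod>i\<in>UNIV. (x $ i) ^ \<alpha> i)"

text \<open>
The weight is chosen such that the fourth moments do not depend on \<open>s\<close> while the second moments are
proportional to \<open>s\<close>.
\<close>

definition antipodal :: "real \<Rightarrow> real \<Rightarrow> real ^ 'n \<Rightarrow> (real ^ 'n \<Rightarrow> real) \<Rightarrow> real" where
  "antipodal \<kappa> s u g = \<kappa> * s\<^sup>2 / 2 * (g ((1 / sqrt s) *\<^sub>R u) + g (- (1 / sqrt s) *\<^sub>R u))"

lemma is_cubature_antipodal: "is_cubature 2 (antipodal \<kappa> s u)"
proof -
  have "is_cubature (1 + 1) (\<lambda>g. \<kappa> * s\<^sup>2 / 2 * g ((1 / sqrt s) *\<^sub>R u) + \<kappa> * s\<^sup>2 / 2 * g (- (1 / sqrt s) *\<^sub>R u))"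
    by (intro is_cubature_add is_cubature_eval)
  then show ?thesis by (simp only: antipodal_def[abs_def] distrib_left one_add_one)
qed

lemma monomial_scaleR: "monomial \<alpha> (c *\<^sub>R x) = c ^ (\<Sum>i\<in>UNIV. \<alpha> i) * monomial \<alpha> (x :: real ^ 'n::finite)"
  by (simp add: monomial_def power_mult_distrib prod.distrib power_sum)

lemma monomial_0: "0 < (\<Sum>i\<in>UNIV. \<alpha> i) \<Longrightarrow> monomial \<alpha> (0 :: real ^ 'n::finite) = 0"
  unfolding monomial_def zero_index power_sum[symmetric] by (rule zero_power)

lemma antipodal_monomial:
  fixes u :: "real ^ 'n::finite"
  assumes s: "s > 0"
  shows "odd (\<Sum>i\<in>UNIV. \<alpha> i) \<Longrightarrow> antipodal \<kappa> s u (monomial \<alpha>) = 0"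
    and "(\<Sum>i\<in>UNIV. \<alpha> i) = 2 \<Longrightarrow> antipodal \<kappa> s u (monomial \<alpha>) = \<kappa> * s * monomial \<alpha> u"
    and "(\<Sum>i\<in>UNIV. \<alpha> i) = 4 \<Longrightarrow> antipodal \<kappa> s u (monomial \<alpha>) = \<kappa> * monomial \<alpha> u"
proof -
  have "(sqrt s) ^ 4 = s\<^sup>2"
    using s power_mult[of "sqrt s" 2 2] by simp
  with s show "(\<Sum>i\<in>UNIV. \<alpha> i) = 4 \<Longrightarrow> antipodal \<kappa> s u (monomial \<alpha>) = \<kappa> * monomial \<alpha> u"
    unfolding antipodal_def monomial_scaleR by (simp add: power_divide)
  from s show "(\<Sum>i\<in>UNIV. \<alpha> i) = 2 \<Longrightarrow> antipodal \<kappa> s u (monomial \<alpha>) = \<kappa> * s * monomial \<alpha> u"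
    unfolding antipodal_def monomial_scaleR by (simp add: power_divide power2_eq_square)
  show "odd (\<Sum>i\<in>UNIV. \<alpha> i) \<Longrightarrow> antipodal \<kappa> s u (monomial \<alpha>) = 0"
    unfolding antipodal_def monomial_scaleR by simp
qed

text \<open>
Monomials are turned into products of coordinates, one index per factor. In this form the moments of degree
two and four are entries of symmetric tensors, which is how the simplex identities are stated.
\<close>

lemma exponents_Suc:
  fixes \<alpha> :: "'n::finite \<Rightarrow> nat"
  assumes "(\<Sum>m\<in>UNIV. \<alpha> m) = Suc d"
  shows "\<exists>i \<beta>. \<alpha> = (\<lambda>m. \<beta> m + of_bool (m = i)) \<and> (\<Sum>m\<in>UNIV. \<beta> m) = d"
proof -
  obtain i where i: "\<alpha> i \<noteq> 0"
    using assms by (metis (no_types, lifting) nat.distinct(1) sum.neutral)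
  define \<beta> where "\<beta> = \<alpha>(i := \<alpha> i - 1)"
  have \<alpha>: "\<alpha> = (\<lambda>m. \<beta> m + of_bool (m = i))" using i by (auto simp: \<beta>_def)
  have "(\<Sum>m\<in>UNIV. of_bool (m = i) :: nat) = 1"
    by simp
  then have "(\<Sum>m\<in>UNIV. \<beta> m) = d"
    using assms unfolding \<alpha> by (simp add: sum.distrib)
  with \<alpha> show ?thesis by blast
qed

lemma exponents_2:
  fixes \<alpha> :: "'n::finite \<Rightarrow> nat"
  assumes "(\<Sum>m\<in>UNIV. \<alpha> m) = 2"
  obtains i j where "\<alpha> = (\<lambda>m. of_bool (m = i) + of_bool (m = j))"
proof -
  obtain i \<beta> where 1: "\<alpha> = (\<lambda>m. \<beta> m + of_bool (m = i))" "(\<Sum>m\<in>UNIV. \<beta> m) = 1"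
    using exponents_Suc[of \<alpha> 1] assms by (auto simp: numeral_2_eq_2)
  obtain j \<delta> where 2: "\<beta> = (\<lambda>m. \<delta> m + of_bool (m = j))" "(\<Sum>m\<in>UNIV. \<delta> m) = 0"
    using exponents_Suc[of \<beta> 0] 1(2) by auto
  show thesis
    using 2(2) by (intro that[of j i]) (simp add: 1(1) 2(1) fun_eq_iff)
qed

lemma exponents_4:
  fixes \<alpha> :: "'n::finite \<Rightarrow> nat"
  assumes "(\<Sum>m\<in>UNIV. \<alpha> m) = 4"
  obtains i j k l where "\<alpha> = (\<lambda>m. of_bool (m = i) + of_bool (m = j) + of_bool (m = k) + of_bool (m = l))"
proof -
  obtain l \<beta> where 1: "\<alpha> = (\<lambda>m. \<beta> m + of_bool (m = l))" "(\<Sum>m\<in>UNIV. \<beta> m) = 3"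
    using exponents_Suc[of \<alpha> 3] assms by auto
  obtain k \<delta> where 2: "\<beta> = (\<lambda>m. \<delta> m + of_bool (m = k))" "(\<Sum>m\<in>UNIV. \<delta> m) = 2"
    using exponents_Suc[of \<beta> 2] 1(2) by auto
  obtain i j where 3: "\<delta> = (\<lambda>m. of_bool (m = i) + of_bool (m = j))"
    using exponents_2[OF 2(2)] .
  show thesis
    by (intro that[of i j k l]) (simp add: 1(1) 2(1) 3)
qed

lemma monomial_2: "monomial (\<lambda>m. of_bool (m = i) + of_bool (m = j)) (x :: real ^ 'n::finite) = x $ i * x $ j"
proof -
  have "(x $ m) ^ of_bool (m = a) = (if m = a then x $ m else 1)" for m a by simp
  then show ?thesis by (simp add: monomial_def power_add prod.distrib)
qed

lemma monomial_4:
  "monomial (\<lambda>m. of_bool (m = i) + of_bool (m = j) + of_bool (m = k) + of_bool (m = l)) (x :: real ^ 'n::finite)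
    = x $ i * x $ j * x $ k * x $ l"
proof -
  have "(x $ m) ^ of_bool (m = a) = (if m = a then x $ m else 1)" for m a by simp
  then show ?thesis by (simp add: monomial_def power_add prod.distrib)
qed

text \<open>
Moments of degree at most five of a symmetric distribution with total mass 1, variance 1 and fourth
moment \<open>b\<close>.
\<close>

definition normalized_moment :: "real \<Rightarrow> nat \<Rightarrow> real" where
  "normalized_moment b k = (if odd k then 0 else if k = 4 then b else 1)"

lemma prod_moment_2:
  fixes b :: "'n::finite \<Rightarrow> real"
  shows "(\<Prod>m\<in>UNIV. normalized_moment (b m) (of_bool (m = i) + of_bool (m = j))) = delta i j"
proof -
  have "(\<Prod>m\<in>UNIV. normalized_moment (b m) (of_bool (m = i) + of_bool (m = j)))
      = (\<Prod>m\<in>{i, j}. normalized_moment (b m) (of_bool (m = i) + of_bool (m = j)))"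
    by (rule prod.mono_neutral_right) (auto simp: normalized_moment_def)
  also have "\<dots> = delta i j"
    by (cases "i = j") (simp_all add: normalized_moment_def delta_def)
  finally show ?thesis .
qed

text \<open>
The first three summands are the moments of independent standard normal variables, whose fourth
moment is 3; this is why \<open>b - 3\<close> is the deviation from isotropy.
\<close>

lemma prod_moment_4:
  fixes b :: "'n::finite \<Rightarrow> real"
  shows "(\<Prod>m\<in>UNIV. normalized_moment (b m)
      (of_bool (m = i) + of_bool (m = j) + of_bool (m = k) + of_bool (m = l)))
    = delta i j * delta k l + delta i k * delta j l + delta i l * delta j k + (b i - 3) * (delta i j * delta i k * delta i l)"
    (is "(\<Prod>m\<in>UNIV. ?f m) = ?R")
proof -
  have "(\<Prod>m\<in>UNIV. ?f m) = (\<Prod>m\<in>{i, j, k, l}. ?f m)"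
    by (rule prod.mono_neutral_right) (auto simp: normalized_moment_def)
  also have "\<dots> = ?R"
    by (cases "i = j"; cases "i = k"; cases "i = l"; cases "j = k"; cases "j = l"; cases "k = l")
       (simp_all add: normalized_moment_def delta_def prod.insert_if)
  finally show ?thesis .
qed

section \<open>Degree five for normalized moments\<close>

lemma antipodal_axis_sum_2:
  "(\<Sum>m\<in>UNIV. \<gamma> m * \<epsilon> * (axis m 1 $ i * (axis m 1 :: real ^ 'n::finite) $ j)) = \<epsilon> * \<gamma> i * delta i j"
proof -
  have "(\<Sum>m\<in>UNIV. \<gamma> m * \<epsilon> * (axis m 1 $ i * (axis m 1 :: real ^ 'n::finite) $ j))
    = (\<Sum>m\<in>UNIV. if m = i then \<epsilon> * \<gamma> i * delta i j else 0)"
    by (intro sum.cong refl) (auto simp: axis_def delta_def)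
  then show ?thesis by simp
qed

lemma antipodal_axis_sum_4:
  "(\<Sum>m\<in>UNIV. \<gamma> m * (axis m 1 $ i * axis m 1 $ j * axis m 1 $ k * (axis m 1 :: real ^ 'n::finite) $ l))
    = \<gamma> i * (delta i j * delta i k * delta i l)"
proof -
  have "(\<Sum>m\<in>UNIV. \<gamma> m * (axis m 1 $ i * axis m 1 $ j * axis m 1 $ k * (axis m 1 :: real ^ 'n::finite) $ l))
    = (\<Sum>m\<in>UNIV. if m = i then \<gamma> i * (delta i j * delta i k * delta i l) else 0)"
    by (intro sum.cong refl) (auto simp: axis_def delta_def)
  then show ?thesis by simp
qed

text \<open>
For odd total degree both sides vanish, the right one because some exponent is odd. Degree zero is matched
by the weight at the origin, and degrees two and four are the tensor identities for the simplex and the axes.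
\<close>

theorem normalized_cubature:
  fixes b :: "'n::finite \<Rightarrow> real"
  assumes n4: "CARD('n) \<ge> 4"
  shows "\<exists>F :: (real ^ 'n \<Rightarrow> real) \<Rightarrow> real. is_cubature (CARD('n) ^ 2 + 5 * CARD('n) + 3) F \<and>
    (\<forall>\<alpha>. (\<Sum>i\<in>UNIV. \<alpha> i) \<le> 5 \<longrightarrow>
      F (monomial \<alpha>) = (\<Prod>i\<in>UNIV. normalized_moment (b i) (\<alpha> i)))"
proof -
  interpret tight_frame "simplex_vertex :: 'n option \<Rightarrow> 'n \<Rightarrow> real"
    by unfold_locales (rule simplex_vertex_sum simplex_vertex_frame)+
  define n where "n = real CARD('n)"
  have K: "CARD('n option) > 4" "real CARD('n option) = n + 1"
    using n4 by (simp_all add: n_def)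
  define \<gamma> where "\<gamma> i = b i - 3" for i
  define D where "D = diag_coeff \<gamma>"
  \<comment> \<open>Small enough that the perturbation of \<open>1/6\<close> stays below \<open>1/6\<close> at every pair of vertices.\<close>
  define \<epsilon> where "\<epsilon> = 1 / (6 * (1 + (\<Sum>(k, l)\<in>UNIV. \<bar>D k l\<bar>)))"
  define s where "s k l = 1 / 6 - \<epsilon> * D k l" for k l
  define v :: "'n option \<Rightarrow> real ^ 'n" where "v k = (\<chi> i. simplex_vertex k i)" for k
  have total_nonneg: "0 \<le> (\<Sum>(k, l)\<in>UNIV. \<bar>D k l\<bar>)"
    by (rule sum_nonneg) auto
  then have \<epsilon>: "\<epsilon> > 0" by (simp add: \<epsilon>_def)
  have s: "s k l > 0" for k l
  proof -
    have "\<bar>D k l\<bar> \<le> (\<Sum>(k, l)\<in>UNIV. \<bar>D k l\<bar>)"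
      using member_le_sum[of "(k, l)" UNIV "\<lambda>(k, l). \<bar>D k l\<bar>"] by auto
    then have "D k l < 1 + (\<Sum>(k, l)\<in>UNIV. \<bar>D k l\<bar>)" by linarith
    then have "\<epsilon> * D k l < 1 / 6"
      using total_nonneg by (simp add: \<epsilon>_def field_simps)
    then show ?thesis by (simp add: s_def)
  qed
  \<comment> \<open>The origin contributes to degree zero only, and its weight corrects the total mass.\<close>
  define c where "c = 1 - (\<Sum>(k, l)\<in>increasing_pairs. antipodal 1 (s k l) (v k + v l) (monomial (\<lambda>_. 0)))
      - (\<Sum>k\<in>UNIV. antipodal (7 - n) (1 / 6) (v k) (monomial (\<lambda>_. 0)))
      - (\<Sum>i\<in>UNIV. antipodal (\<gamma> i) \<epsilon> (axis i 1) (monomial (\<lambda>_ :: 'n. 0)))"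
  define F where "F g = (\<Sum>(k, l)\<in>increasing_pairs. antipodal 1 (s k l) (v k + v l) g)
      + (\<Sum>k\<in>UNIV. antipodal (7 - n) (1 / 6) (v k) g)
      + (\<Sum>i\<in>UNIV. antipodal (\<gamma> i) \<epsilon> (axis i 1) g) + c * g 0" for g :: "real ^ 'n \<Rightarrow> real"
  have "is_cubature (card (increasing_pairs :: ('n option \<times> 'n option) set) * 2
      + CARD('n option) * 2 + CARD('n) * 2 + 1) F"
    unfolding F_def by (intro is_cubature_add is_cubature_sum is_cubature_eval)
      (auto simp: is_cubature_antipodal)
  moreover have "card (increasing_pairs :: ('n option \<times> 'n option) set) * 2
      + CARD('n option) * 2 + CARD('n) * 2 + 1 = CARD('n) ^ 2 + 5 * CARD('n) + 3"
    using card_increasing_pairs[where 'k = "'n option"] by (simp add: power2_eq_square)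
  ultimately have "is_cubature (CARD('n) ^ 2 + 5 * CARD('n) + 3) F" by (simp only:)
  moreover have "F (monomial \<alpha>) = (\<Prod>i\<in>UNIV. normalized_moment (b i) (\<alpha> i))"
    if "(\<Sum>i\<in>UNIV. \<alpha> i) \<le> 5" for \<alpha>
  proof -
    consider "(\<Sum>i\<in>UNIV. \<alpha> i) = 0" | "odd (\<Sum>i\<in>UNIV. \<alpha> i)" | "(\<Sum>i\<in>UNIV. \<alpha> i) = 2" | "(\<Sum>i\<in>UNIV. \<alpha> i) = 4"
    proof -
      have "d = 0 \<or> odd d \<or> d = 2 \<or> d = 4" if "d \<le> 5" for d :: nat
        using that by presburger
      from this[OF \<open>(\<Sum>i\<in>UNIV. \<alpha> i) \<le> 5\<close>] show thesis
        by (elim disjE) (fact that)+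
    qed
    then show ?thesis
    proof cases
      case 1
      then have "\<alpha> = (\<lambda>_. 0)" by auto
      then show ?thesis by (simp add: F_def c_def monomial_def normalized_moment_def)
    next
      case 2
      \<comment> \<open>A sum of even exponents is even.\<close>
      then obtain i where "odd (\<alpha> i)"
        by (meson dvd_sum)
      then have "normalized_moment (b i) (\<alpha> i) = 0"
        by (simp add: normalized_moment_def)
      then have "(\<Prod>i\<in>UNIV. normalized_moment (b i) (\<alpha> i)) = 0"
        by (auto intro!: prod_zero)
      moreover have "F (monomial \<alpha>) = 0"
        using 2 by (simp add: F_def antipodal_monomial(1) s \<epsilon> monomial_0[OF odd_pos[OF 2]])
      ultimately show ?thesis by simp
    next
      case 3
      have zero: "monomial \<alpha> 0 = 0"
        using 3 by (intro monomial_0) linarith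
      obtain i j where \<alpha>: "\<alpha> = (\<lambda>m. of_bool (m = i) + of_bool (m = j))"
        using exponents_2[OF 3] .
      let ?p = "\<lambda>k l. (simplex_vertex k i + simplex_vertex l i) * (simplex_vertex k j + simplex_vertex l j)"
      have "F (monomial \<alpha>) = (\<Sum>(k, l)\<in>increasing_pairs. s k l * ?p k l)
          + (\<Sum>k\<in>UNIV. (7 - n) / 6 * (simplex_vertex k i * simplex_vertex k j))
          + (\<Sum>m\<in>UNIV. \<gamma> m * \<epsilon> * (axis m 1 $ i * (axis m 1 :: real ^ 'n) $ j))"
        using 3 by (simp add: F_def antipodal_monomial(2) s \<epsilon> zero) (simp add: \<alpha> monomial_2 v_def)
      also have "(\<Sum>(k, l)\<in>increasing_pairs. s k l * ?p k l)
          = 1 / 6 * (\<Sum>(k, l)\<in>increasing_pairs. ?p k l) - \<epsilon> * (\<Sum>(k, l)\<in>increasing_pairs. D k l * ?p k l)"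
        by (simp add: s_def left_diff_distrib sum_subtractf sum_distrib_left case_prod_unfold mult.assoc)
      also have "\<dots> = (n - 1) / 6 * delta i j - \<epsilon> * \<gamma> i * delta i j"
        unfolding D_def increasing_pairs_diag[OF K(1)] increasing_pairs_second K(2) by simp
      also have "(\<Sum>k\<in>UNIV. (7 - n) / 6 * (simplex_vertex k i * simplex_vertex k j)) = (7 - n) / 6 * delta i j"
        by (simp only: sum_distrib_left[symmetric] frame)
      also note antipodal_axis_sum_2
      finally have "F (monomial \<alpha>) = delta i j" by (simp add: field_simps)
      then show ?thesis by (simp add: \<alpha> prod_moment_2)
    next
      case 4
      have zero: "monomial \<alpha> 0 = 0"
        using 4 by (intro monomial_0) linarith
      obtain i j k l where \<alpha>: "\<alpha> = (\<lambda>m. of_bool (m = i) + of_bool (m = j) + of_bool (m = k) + of_bool (m = l))"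
        using exponents_4[OF 4] .
      have "F (monomial \<alpha>) = (\<Sum>(p, q)\<in>increasing_pairs. (simplex_vertex p i + simplex_vertex q i)
            * (simplex_vertex p j + simplex_vertex q j) * (simplex_vertex p k + simplex_vertex q k)
            * (simplex_vertex p l + simplex_vertex q l))
          + (\<Sum>p\<in>UNIV. (7 - n) * (simplex_vertex p i * simplex_vertex p j * simplex_vertex p k * simplex_vertex p l))
          + (\<Sum>m\<in>UNIV. \<gamma> m * (axis m 1 $ i * axis m 1 $ j * axis m 1 $ k * (axis m 1 :: real ^ 'n) $ l))"
        using 4 by (simp add: F_def antipodal_monomial(3) s \<epsilon> zero) (simp add: \<alpha> monomial_4 v_def)
      also have "\<dots> = (delta i j * delta k l + delta i k * delta j l + delta i l * delta j k) + (b i - 3) * (delta i j * delta i k * delta i l)"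
        unfolding increasing_pairs_fourth antipodal_axis_sum_4 sum_distrib_left[symmetric] K(2) \<gamma>_def
        by (simp add: algebra_simps)
      finally show ?thesis by (simp add: \<alpha> prod_moment_4)
    qed
  qed
  ultimately show ?thesis by blast
qed

section \<open>Moments of the product weight\<close>

lemma set_integrable_mult_power:
  fixes r :: "real \<Rightarrow> real"
  assumes "set_integrable lebesgue {-1..1} r"
  shows "set_integrable lebesgue {-1..1} (\<lambda>x. r x * x ^ k)"
  unfolding set_integrable_def
proof (rule Bochner_Integration.integrable_bound)
  show r: "integrable lebesgue (\<lambda>x. indicator {-1..1} x *\<^sub>R r x)"
    using assms by (simp add: set_integrable_def)
  have "(\<lambda>x :: real. x ^ k) \<in> borel_measurable lebesgue"
    by (rule measurable_completion) simp
  then have "(\<lambda>x. (indicator {-1..1} x *\<^sub>R r x) * x ^ k) \<in> borel_measurable lebesgue"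
    using r by (intro borel_measurable_times) auto
  then show "(\<lambda>x. indicator {-1..1} x *\<^sub>R (r x * x ^ k)) \<in> borel_measurable lebesgue"
    by (simp add: mult.assoc)
  have "\<bar>x\<bar> ^ k \<le> 1" if "x \<in> {-1..1}" for x :: real
    using that by (intro power_le_one) auto
  then have "norm (indicator {-1..1} x *\<^sub>R (r x * x ^ k)) \<le> norm (indicator {-1..1} x *\<^sub>R r x)" for x
    by (auto simp: indicator_def abs_mult power_abs mult_left_le)
  then show "AE x in lebesgue. norm (indicator {-1..1} x *\<^sub>R (r x * x ^ k)) \<le> norm (indicator {-1..1} x *\<^sub>R r x)"
    by simp
qed

text \<open>
If the second moment were zero, the weight would vanish almost everywhere off the origin, hence almost
everywhere, and could not have nonzero mass.
\<close>

lemma second_moment_pos: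
  fixes r :: "real \<Rightarrow> real"
  assumes nonneg: "\<And>x. x \<in> {-1..1} \<Longrightarrow> r x \<ge> 0"
    and int: "set_integrable lebesgue {-1..1} r"
    and total: "(LINT x : {-1..1} | lebesgue. r x) \<noteq> 0"
  shows "(LINT x : {-1..1} | lebesgue. r x * x ^ 2) > 0"
proof (rule ccontr)
  let ?h = "\<lambda>x. indicator {-1..1} x *\<^sub>R (r x * x ^ 2)"
  have h: "integrable lebesgue ?h"
    using set_integrable_mult_power[OF int, of 2] by (simp add: set_integrable_def)
  have pos: "?h x \<ge> 0" for x
    using nonneg[of x] by (auto simp: indicator_def)
  assume "\<not> ?thesis"
  moreover have "(LINT x : {-1..1} | lebesgue. r x * x ^ 2) \<ge> 0"
    unfolding set_lebesgue_integral_def using pos by (intro Bochner_Integration.integral_nonneg_AE) simp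
  ultimately have "integral\<^sup>L lebesgue ?h = 0"
    by (simp add: set_lebesgue_integral_def)
  then have "AE x in lebesgue. ?h x = 0"
    using integral_nonneg_eq_0_iff_AE[OF h] pos by simp
  moreover have "AE x in lebesgue. x \<noteq> (0 :: real)"
    by (rule AE_completion) (rule AE_lborel_singleton)
  ultimately have "AE x in lebesgue. indicator {-1..1} x *\<^sub>R r x = 0"
    by eventually_elim (auto simp: indicator_def)
  then have "(LINT x : {-1..1} | lebesgue. r x) = 0"
    unfolding set_lebesgue_integral_def by (rule integral_eq_zero_AE)
  with total show False by simp
qed

lemma monomial_integral:
  fixes \<rho> :: "'n::finite \<Rightarrow> real \<Rightarrow> real"
  assumes "\<And>i. set_integrable lebesgue {-1..1} (\<rho> i)"
  shows "set_integrable lebesgue (cbox (- 1) 1) (\<lambda>x :: real ^ 'n. (\<Prod>i\<in>UNIV. \<rho> i (x $ i)) * monomial \<alpha> x)"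
    and "product_integral \<rho> (monomial \<alpha>) = (\<Prod>i\<in>UNIV. LINT t : {-1..1} | lebesgue. \<rho> i t * t ^ \<alpha> i)"
proof -
  let ?f = "\<lambda>i t. indicator {-1..1} t *\<^sub>R (\<rho> i t * t ^ \<alpha> i)"
  have f: "integrable lebesgue (?f i)" for i
    using set_integrable_mult_power[OF assms, of i "\<alpha> i"] by (simp add: set_integrable_def)
  have eq: "indicator (cbox (- 1) 1) x *\<^sub>R ((\<Prod>i\<in>UNIV. \<rho> i (x $ i)) * monomial \<alpha> x) = (\<Prod>i\<in>UNIV. ?f i (x $ i))"
    for x :: "real ^ 'n"
  proof -
    have "indicator (cbox (- 1) 1) x = (\<Prod>i\<in>UNIV. indicator {-1..1} (x $ i) :: real)"
    proof (cases "x \<in> cbox (- 1) 1")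
      case True
      then show ?thesis by (simp add: mem_box_cart)
    next
      case False
      then obtain i where "x $ i \<notin> {-1..1}" by (auto simp: mem_box_cart)
      then have "(\<Prod>i\<in>UNIV. indicator {-1..1} (x $ i) :: real) = 0"
        by (intro prod_zero bexI[of _ i]) auto
      with False show ?thesis by simp
    qed
    then show ?thesis by (simp add: prod.distrib monomial_def)
  qed
  show "set_integrable lebesgue (cbox (- 1) 1) (\<lambda>x :: real ^ 'n. (\<Prod>i\<in>UNIV. \<rho> i (x $ i)) * monomial \<alpha> x)"
    unfolding set_integrable_def eq by (rule lebesgue_prod_integral[OF f])
  show "product_integral \<rho> (monomial \<alpha>) = (\<Prod>i\<in>UNIV. LINT t : {-1..1} | lebesgue. \<rho> i t * t ^ \<alpha> i)"
    unfolding product_integral_def set_lebesgue_integral_def eq by (rule lebesgue_prod_integral[OF f])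
qed

lemma has_degree_monomials:
  assumes int: "\<And>i. set_integrable lebesgue {-1..1} (\<rho> i)"
    and C: "is_cubature N C"
    and mon: "\<And>\<alpha>. (\<Sum>i\<in>UNIV. \<alpha> i) \<le> d \<Longrightarrow> C (monomial \<alpha>) = product_integral \<rho> (monomial \<alpha>)"
  shows "has_degree C (product_integral (\<rho> :: 'n::finite \<Rightarrow> real \<Rightarrow> real)) d"
  unfolding has_degree_def poly_fun_le_def
proof (intro allI impI, elim exE)
  fix f :: "real ^ 'n \<Rightarrow> real" and c
  let ?A = "{\<alpha> :: 'n \<Rightarrow> nat. (\<Sum>i\<in>UNIV. \<alpha> i) \<le> d}"
  assume "\<forall>x. f x = (\<Sum>\<alpha>\<in>?A. c \<alpha> * (\<Prod>i\<in>UNIV. (x $ i) ^ \<alpha> i))"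
  then have f: "f = (\<lambda>x. \<Sum>\<alpha>\<in>?A. c \<alpha> * monomial \<alpha> x)"
    by (simp add: monomial_def fun_eq_iff)
  have "C f = (\<Sum>\<alpha>\<in>?A. c \<alpha> * C (monomial \<alpha>))"
    unfolding f by (rule is_cubature_linear[OF C])
  also have "\<dots> = (\<Sum>\<alpha>\<in>?A. c \<alpha> * product_integral \<rho> (monomial \<alpha>))"
    by (intro sum.cong refl) (simp add: mon)
  also have "\<dots> = product_integral \<rho> f"
  proof -
    let ?h = "\<lambda>\<alpha> x. indicator (cbox (- 1) 1) x *\<^sub>R ((\<Prod>i\<in>UNIV. \<rho> i (x $ i)) * monomial \<alpha> x)"
    have h: "integrable lebesgue (?h \<alpha>)" for \<alpha>
      using monomial_integral(1)[OF int] by (simp add: set_integrable_def)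
    have "product_integral \<rho> f = integral\<^sup>L lebesgue (\<lambda>x. \<Sum>\<alpha>\<in>?A. c \<alpha> * ?h \<alpha> x)"
      unfolding product_integral_def set_lebesgue_integral_def f
      by (simp add: sum_distrib_left mult_ac)
    also have "\<dots> = (\<Sum>\<alpha>\<in>?A. c \<alpha> * integral\<^sup>L lebesgue (?h \<alpha>))"
      by (subst Bochner_Integration.integral_sum) (simp_all only: integrable_mult_right integral_mult_right_zero h)
    finally show ?thesis
      by (simp only: product_integral_def set_lebesgue_integral_def)
  qed
  finally show "C f = product_integral \<rho> f" .
qed

theorem theorem1:
  fixes \<rho> :: "'n::finite \<Rightarrow> real \<Rightarrow> real"
  assumes "CARD('n) \<ge> 4"
    and "\<And>i x. x \<in> {-1..1} \<Longrightarrow> \<rho> i x \<ge> 0"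
    and "\<And>i x. x \<in> {-1..1} \<Longrightarrow> \<rho> i (- x) = \<rho> i x"
    and "\<And>i. set_integrable lebesgue {-1..1} (\<rho> i)"
    and "\<And>i. (LINT x : {-1..1} | lebesgue. \<rho> i x) = 1"
    and "\<And>i (k :: nat). (LINT x : {-1..1} | lebesgue. \<rho> i x * x ^ (2 * k + 1)) = 0"
  shows "\<exists>N w (p :: nat \<Rightarrow> real ^ 'n).
           N \<le> CARD('n) ^ 2 + 5 * CARD('n) + 3 \<and>
           has_degree (cubature N w p) (product_integral \<rho>) 5"
proof -
  define M where "M i k = (LINT x : {-1..1} | lebesgue. \<rho> i x * x ^ k)" for i k
  define \<sigma> where "\<sigma> i = sqrt (M i 2)" for i
  \<comment> \<open>The fourth moment after normalization, also known as the kurtosis.\<close>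
  define b where "b i = M i 4 / (M i 2)\<^sup>2" for i
  have pos: "M i 2 > 0" for i
    unfolding M_def by (rule second_moment_pos) (use assms(2,4,5) in auto)
  have \<sigma>2: "\<sigma> i ^ 2 = M i 2" for i
    using pos[of i] by (simp add: \<sigma>_def)
  then have \<sigma>4: "\<sigma> i ^ 4 = (M i 2)\<^sup>2" for i
    using power_mult[of "\<sigma> i" 2 2] by simp
  have M: "M i k = \<sigma> i ^ k * normalized_moment (b i) k" if "k \<le> 5" for i k
  proof -
    have "k = 0 \<or> odd k \<or> k = 2 \<or> k = 4" using that by presburger
    then show ?thesis
    proof (elim disjE)
      assume "odd k"
      then obtain m where "k = 2 * m + 1" by (rule oddE)
      then show ?thesis using assms(6)[of i m] by (simp add: M_def normalized_moment_def)
    next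
      assume "k = 4"
      then show ?thesis using pos[of i] by (simp add: normalized_moment_def b_def \<sigma>4)
    qed (use assms(5)[of i] in \<open>auto simp: M_def[of _ 0] \<sigma>2 normalized_moment_def\<close>)
  qed
  obtain F :: "(real ^ 'n \<Rightarrow> real) \<Rightarrow> real"
    where F: "is_cubature (CARD('n) ^ 2 + 5 * CARD('n) + 3) F"
      and Fm: "\<And>\<alpha>. (\<Sum>i\<in>UNIV. \<alpha> i) \<le> 5 \<Longrightarrow> F (monomial \<alpha>) = (\<Prod>i\<in>UNIV. normalized_moment (b i) (\<alpha> i))"
    using normalized_cubature[OF assms(1), of b] by blast
  \<comment> \<open>Scaling by the standard deviations undoes the normalization.\<close>
  let ?S = "\<lambda>x :: real ^ 'n. \<chi> i. \<sigma> i * x $ i"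
  let ?C = "\<lambda>g. F (\<lambda>x. g (?S x))"
  have C: "is_cubature (CARD('n) ^ 2 + 5 * CARD('n) + 3) ?C"
    using F by (rule is_cubature_map)
  have "has_degree ?C (product_integral \<rho>) 5"
  proof (rule has_degree_monomials[OF assms(4) C])
    fix \<alpha> :: "'n \<Rightarrow> nat"
    assume \<alpha>: "(\<Sum>i\<in>UNIV. \<alpha> i) \<le> 5"
    have "\<alpha> i \<le> 5" for i
      using member_le_sum[of i UNIV \<alpha>] \<alpha> by simp
    then have "product_integral \<rho> (monomial \<alpha>)
        = (\<Prod>i\<in>UNIV. \<sigma> i ^ \<alpha> i * normalized_moment (b i) (\<alpha> i))"
      unfolding monomial_integral(2)[OF assms(4)] M_def[symmetric] by (intro prod.cong refl M)
    also have "\<dots> = (\<Prod>i\<in>UNIV. \<sigma> i ^ \<alpha> i) * F (monomial \<alpha>)"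
      by (simp add: prod.distrib Fm[OF \<alpha>])
    also have "\<dots> = F (\<lambda>x. (\<Prod>i\<in>UNIV. \<sigma> i ^ \<alpha> i) * monomial \<alpha> x)"
      by (rule is_cubature_cmult[OF F, symmetric])
    also have "(\<lambda>x. (\<Prod>i\<in>UNIV. \<sigma> i ^ \<alpha> i) * monomial \<alpha> x) = (\<lambda>x. monomial \<alpha> (?S x))"
      by (simp add: monomial_def power_mult_distrib prod.distrib)
    finally show "?C (monomial \<alpha>) = product_integral \<rho> (monomial \<alpha>)" by simp
  qed
  with C show ?thesis unfolding is_cubature_def by (metis order_refl)
qed

end
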